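(* Let $X,Y$ be metric spaces, let $(f_k)_{k\ge1}$ be a sequence of $(-\infty,\infty]$-valued functions on $X$ that $\Gamma$-converges to $f$, and let $\theta:X\to Y$ be continuous. Assume that for each $k\ge1$, $f_k$ is coercive and that the sequence $(f_k)_{k\ge1}$ is equi-coercive, i.e. for all $a\ge0$, $\bigcup_{k\ge1}\{f_k\le a\}$ is relatively compact in $X$. Then the sequence of functions $(\psi_k)_{k\ge1}$ on $Y$ defined by $$\psi_k(y):=\inf\{f_k(x);\ x\in X:\theta(x)=y\},\quad y\in Y,\ k\ge1,$$ $\Gamma$-converges to $$\psi(y):=\inf\{f(x);\ x\in X:\theta(x)=y\},\quad y\in Y.$$ In particular, for any $y^*\in Y$ there exists a sequence $(y_k^* )_{k\ge1}$ in $Y$ such that $\lim_{k\to\infty}y_k^*=y^*$ and $$\lim_{k\to\infty}\inf\{f_k(x);\ x\in X:\theta(x)=y_k^*\}=\inf\{f(x);\ x\in X:\theta(x)=y^*\}\in(-\infty,\infty].$$ Moreover, with this sequence, if $y^*$ satisfies $\inf\{f(x);\ x\in X:\theta(x)=y^*\}<\infty$, then for each $k\ge1$ the minimization problem $$f_k(x)\to\min;\quad x\in X:\theta(x)=y_k^*$$ admits at least one minimizer $\hat x_k\in X$. Any sequence $(\hat x_k)_{k\ge1}$ of such minimizers admits at least one limit point, and any such limit point is a solution to the minimization problem $$f(x)\to\min;\quad x\in X:\theta(x)=y^*.$$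
   Context: A function is coercive if all its sublevel sets $\{f\le a\}$, $a\in\mathbb R$, are compact. $\Gamma\text{-}\lim_kf_k=f$ on a topological space $E$ means that for every $x\in E$, $\sup_V\liminf_k\inf_Vf_k=\sup_V\limsup_k\inf_Vf_k=f(x)$, where $V$ ranges over the neighborhoods of $x$. The infimum over the empty set is $+\infty$.
   Formalization: The Γ-limit f is assumed to be (−∞,∞]-valued, like the f_k; otherwise the claim that the infimum of f over each fibre lies in (−∞,∞] fails, e.g. for f_k = −k on a one-point space. *)

theory Defs
  imports "HOL-Analysis.Analysis"
begin

definition coercive :: "('a::topological_space \<Rightarrow> ereal) \<Rightarrow> bool" where
  "coercive f \<longleftrightarrow> (\<forall>a::real. compact {x. f x \<le> ereal a})"

text \<open>Sequences are indexed by \<open>k \<ge> 1\<close>; the value at index \<open>0\<close> is irrelevant throughout.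
  Relative compactness means compactness of the closure.\<close>

definition equi_coercive :: "(nat \<Rightarrow> 'a::topological_space \<Rightarrow> ereal) \<Rightarrow> bool" where
  "equi_coercive f \<longleftrightarrow>
    (\<forall>a::real. a \<ge> 0 \<longrightarrow> compact (closure (\<Union>k\<in>{1..}. {x. f k x \<le> ereal a})))"

text \<open>The neighbourhoods of \<open>x\<close> are the sets (not necessarily open) with \<open>x\<close> in their interior.\<close>

definition gamma_converges ::
  "(nat \<Rightarrow> 'a::topological_space \<Rightarrow> ereal) \<Rightarrow> ('a \<Rightarrow> ereal) \<Rightarrow> bool" where
  "gamma_converges f g \<longleftrightarrow>
    (\<forall>x. (SUP V\<in>{V. x \<in> interior V}. liminf (\<lambda>k. INF z\<in>V. f k z)) = g x \<and>
         (SUP V\<in>{V. x \<in> interior V}. limsup (\<lambda>k. INF z\<in>V. f k z)) = g x)"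

text \<open>On an empty fibre the infimum is \<open>\<infinity>\<close>, the top element of \<^typ>\<open>ereal\<close>.\<close>

definition fibre_inf :: "('a \<Rightarrow> 'b) \<Rightarrow> ('a \<Rightarrow> ereal) \<Rightarrow> 'b \<Rightarrow> ereal" where
  "fibre_inf \<theta> f y = (INF x\<in>{x. \<theta> x = y}. f x)"

definition seq_limit_point :: "(nat \<Rightarrow> 'a::topological_space) \<Rightarrow> 'a \<Rightarrow> bool" where
  "seq_limit_point s l \<longleftrightarrow> (\<exists>r::nat \<Rightarrow> nat. strict_mono r \<and> (s \<circ> r) \<longlonglongrightarrow> l)"

end

theory Submission
  imports Defs
begin

text \<open>
  The infimum of \<open>fibre_inf \<theta> (f k)\<close> over \<open>V\<close> is the infimum of \<open>f k\<close> over \<open>\<theta> -` V\<close>, so the upper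
  bound for the \<open>\<Gamma>\<close>-limit only uses continuity of \<open>\<theta>\<close>. For the lower bound, points with values
  \<open>f k \<le> a\<close> whose images approach \<open>y\<close> accumulate by equi-coercivity at a point of the fibre over
  \<open>y\<close>, where \<open>g \<le> a\<close> by the \<open>\<Gamma>\<close>-liminf inequality. The same compactness argument,
  applied to minimizers over the fibres along a recovery sequence of \<open>fibre_inf \<theta> g\<close> at \<open>y\<close>,
  yields the remaining claims.
\<close>

section \<open>Gamma-limits: the liminf inequality and recovery sequences\<close>

lemma gamma_convergesD:
  assumes "gamma_converges f g"
  shows "(SUP V\<in>{V. x \<in> interior V}. liminf (\<lambda>k. INF z\<in>V. f k z)) = g x"
    and "(SUP V\<in>{V. x \<in> interior V}. limsup (\<lambda>k. INF z\<in>V. f k z)) = g x"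
  using assms by (auto simp: gamma_converges_def)

text \<open>Since liminf is at most limsup for each \<open>V\<close>, a lower bound on the first
  supremum and an upper bound on the second squeeze both to \<open>g x\<close>.\<close>

lemma gamma_convergesI:
  assumes "\<And>x. g x \<le> (SUP V\<in>{V. x \<in> interior V}. liminf (\<lambda>k. INF z\<in>V. f k z))"
    and "\<And>x V. x \<in> interior V \<Longrightarrow> limsup (\<lambda>k. INF z\<in>V. f k z) \<le> g x"
  shows "gamma_converges f g"
proof -
  have "(SUP V\<in>{V. x \<in> interior V}. liminf (\<lambda>k. INF z\<in>V. f k z))
      \<le> (SUP V\<in>{V. x \<in> interior V}. limsup (\<lambda>k. INF z\<in>V. f k z))" for x
    by (intro SUP_subset_mono Liminf_le_Limsup) auto
  moreover have "(SUP V\<in>{V. x \<in> interior V}. limsup (\<lambda>k. INF z\<in>V. f k z)) \<le> g x" for x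
    using assms(2) by (intro SUP_least) auto
  ultimately show ?thesis
    using assms(1) unfolding gamma_converges_def by (meson order.antisym order.trans)
qed

text \<open>A neighbourhood \<open>V\<close> of \<open>x\<close> eventually contains
  \<open>xs j\<close>, so the infimum over \<open>V\<close> lies below the value at
  \<open>xs j\<close>; passing to a subsequence can only raise the liminf. The index map
  \<open>r\<close> is there for sequences extracted by compactness.\<close>

lemma gamma_converges_liminf_le:
  fixes xs :: "nat \<Rightarrow> 'a::topological_space"
  assumes "gamma_converges f g" and "strict_mono r" and "xs \<longlonglongrightarrow> x"
  shows "g x \<le> liminf (\<lambda>j. f (r j) (xs j))"
proof -
  have "liminf (\<lambda>k. INF z\<in>V. f k z) \<le> liminf (\<lambda>j. f (r j) (xs j))" if "x \<in> interior V" for V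
  proof -
    have "liminf (\<lambda>k. INF z\<in>V. f k z) \<le> liminf ((\<lambda>k. INF z\<in>V. f k z) \<circ> r)"
      using assms(2) by (rule liminf_subseq_mono)
    also have "\<dots> \<le> liminf (\<lambda>j. f (r j) (xs j))"
    proof (rule Liminf_mono)
      have "\<forall>\<^sub>F j in sequentially. xs j \<in> interior V"
        using assms(3) that by (simp add: topological_tendstoD)
      then show "\<forall>\<^sub>F j in sequentially. ((\<lambda>k. INF z\<in>V. f k z) \<circ> r) j \<le> f (r j) (xs j)"
        by eventually_elim (use interior_subset in \<open>auto intro!: INF_lower\<close>)
    qed
    finally show ?thesis .
  qed
  then show ?thesis
    unfolding gamma_convergesD(1)[OF assms(1), symmetric] by (auto intro!: SUP_least)
qed

text \<open>Take \<open>h k\<close> to be the largest \<open>n\<close> with \<open>n \<le> k\<close>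
  and \<open>P n k\<close>. The cap \<open>n \<le> k\<close> keeps the candidates finite, and each
  fixed \<open>n\<close> is eventually a candidate, which pushes the maximum to infinity.\<close>

lemma eventually_sequentially_diagonal:
  fixes P :: "nat \<Rightarrow> nat \<Rightarrow> bool"
  assumes "\<And>n. eventually (P n) sequentially"
  shows "\<exists>h. filterlim h at_top sequentially \<and> (\<forall>\<^sub>F k in sequentially. P (h k) k)"
proof -
  define A where "A k = {n. n \<le> k \<and> P n k}" for k
  have finA: "finite (A k)" for k
    by (rule finite_subset[of _ "{..k}"]) (auto simp: A_def)
  have ev: "\<forall>\<^sub>F k in sequentially. n \<in> A k" for n
    using assms[of n] eventually_ge_at_top[of n] by eventually_elim (auto simp: A_def)
  have "filterlim (\<lambda>k. Max (A k)) at_top sequentially"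
    unfolding filterlim_at_top
  proof
    fix n show "\<forall>\<^sub>F k in sequentially. n \<le> Max (A k)"
      using ev[of n] by eventually_elim (use finA in auto)
  qed
  moreover have "\<forall>\<^sub>F k in sequentially. P (Max (A k)) k"
    using ev[of 0]
  proof eventually_elim
    case (elim k)
    then have "Max (A k) \<in> A k"
      using finA by (intro Max_in) auto
    then show ?case by (simp add: A_def)
  qed
  ultimately show ?thesis by blast
qed

lemma gamma_converges_recovery_sequence:
  fixes x :: "'a::metric_space"
  assumes "gamma_converges f g"
  shows "\<exists>xs. xs \<longlonglongrightarrow> x \<and> (\<lambda>k. f k (xs k)) \<longlonglongrightarrow> g x"
\<comment> \<open>At the value \<open>\<infinity>\<close> nothing lies strictly above
  \<open>g x\<close>; there the liminf inequality alone makes the constant sequence a recovery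
  sequence.\<close>
proof (cases "g x = \<infinity>")
  case True
  have "\<infinity> \<le> liminf (\<lambda>k. f k x)"
    using gamma_converges_liminf_le[OF assms strict_mono_id tendsto_const, of x] True by simp
  then have "(\<lambda>k. f k x) \<longlonglongrightarrow> \<infinity>"
    by (simp add: Liminf_PInfty)
  then show ?thesis
    using True tendsto_const[of x sequentially] by (intro exI[of _ "\<lambda>_. x"]) simp
next
  case False
  \<comment> \<open>Levels \<open>c n\<close> replace \<open>g x + 1/n\<close>, which would not
    exceed \<open>g x\<close> if \<open>g x = -\<infinity>\<close>. Strictness turns the bound on
    the limsup into actual points of the ball with value below \<open>c n\<close>.\<close>
  then obtain c :: "nat \<Rightarrow> ereal" where c: "\<And>n. c n > g x" "c \<longlonglongrightarrow> g x"
    using approx_from_above_dense_linorder[of "g x" \<infinity>] by (auto simp: less_top)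
  define P where "P n k \<longleftrightarrow> (\<exists>z. dist z x < inverse (Suc n) \<and> f k z < c n)" for n k
  have "eventually (P n) sequentially" for n
  proof -
    let ?V = "ball x (inverse (real (Suc n)))"
    have "limsup (\<lambda>k. INF z\<in>?V. f k z) \<le> g x"
      unfolding gamma_convergesD(2)[OF assms, symmetric]
      by (intro SUP_upper) (auto simp: interior_open)
    then have "limsup (\<lambda>k. INF z\<in>?V. f k z) < c n"
      using c(1) by (rule le_less_trans)
    then have "\<forall>\<^sub>F k in sequentially. (INF z\<in>?V. f k z) < c n"
      by (rule Limsup_lessD)
    then show ?thesis
      by eventually_elim (auto simp: P_def INF_less_iff dist_commute)
  qed
  then obtain h where h: "filterlim h at_top sequentially" "\<forall>\<^sub>F k in sequentially. P (h k) k"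
    using eventually_sequentially_diagonal by blast
  have "\<exists>xs. \<forall>k. P (h k) k \<longrightarrow> dist (xs k) x < inverse (Suc (h k)) \<and> f k (xs k) < c (h k)"
    unfolding P_def by (intro choice) blast
  then obtain xs where
    xs: "\<And>k. P (h k) k \<Longrightarrow> dist (xs k) x < inverse (Suc (h k)) \<and> f k (xs k) < c (h k)"
    by blast
  have "(\<lambda>k. dist (xs k) x) \<longlonglongrightarrow> 0"
  proof (rule tendsto_sandwich[OF _ _ tendsto_const])
    show "(\<lambda>k. inverse (real (Suc (h k)))) \<longlonglongrightarrow> 0"
      using filterlim_compose[OF LIMSEQ_inverse_real_of_nat h(1)] .
    show "\<forall>\<^sub>F k in sequentially. dist (xs k) x \<le> inverse (real (Suc (h k)))"
      using h(2) by eventually_elim (use xs in force)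
  qed simp
  then have lim: "xs \<longlonglongrightarrow> x"
    by (rule tendsto_dist_iff[THEN iffD2])
  have "g x \<le> liminf (\<lambda>k. f k (xs k))"
    using gamma_converges_liminf_le[OF assms strict_mono_id lim] by simp
  moreover have "limsup (\<lambda>k. f k (xs k)) \<le> limsup (\<lambda>k. c (h k))"
    by (rule Limsup_mono) (use h(2) in eventually_elim, use xs in force)
  moreover have "limsup (\<lambda>k. c (h k)) = g x"
    using filterlim_compose[OF c(2) h(1)] by (intro lim_imp_Limsup) auto
  moreover have "liminf (\<lambda>k. f k (xs k)) \<le> limsup (\<lambda>k. f k (xs k))"
    by (intro Liminf_le_Limsup) auto
  ultimately have "(\<lambda>k. f k (xs k)) \<longlonglongrightarrow> g x"
    by (intro Liminf_eq_Limsup) auto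
  with lim show ?thesis by blast
qed

section \<open>Compactness from coercivity\<close>

lemma equi_coercive_convergent_subseq:
  fixes xs :: "nat \<Rightarrow> 'a::metric_space"
  assumes "equi_coercive f" and "strict_mono r"
    and "\<forall>\<^sub>F j in sequentially. f (r j) (xs j) \<le> ereal a"
  shows "\<exists>l s. strict_mono s \<and> (xs \<circ> s) \<longlonglongrightarrow> l"
proof -
  \<comment> \<open>Equi-coercivity speaks only of nonnegative levels and indices from 1 on, hence
    \<open>max a 0\<close> here and \<open>r j \<ge> 1\<close> below.\<close>
  define K where "K = closure (\<Union>k\<in>{1..}. {x. f k x \<le> ereal (max a 0)})"
  have "compact K"
    using assms(1) unfolding equi_coercive_def K_def by (meson max.cobounded2)
  have "\<forall>\<^sub>F j in sequentially. xs j \<in> K"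
    using assms(3) eventually_ge_at_top[of 1]
  proof eventually_elim
    case (elim j)
    have "f (r j) (xs j) \<le> ereal (max a 0)"
      using elim(1) by (rule order.trans) simp
    moreover have "r j \<ge> 1"
      using seq_suble[OF assms(2), of j] elim(2) by simp
    ultimately show ?case
      using closure_subset unfolding K_def by fastforce
  qed
  then obtain N where "\<And>j. j \<ge> N \<Longrightarrow> xs j \<in> K"
    by (auto simp: eventually_sequentially)
  then have "\<forall>j. (\<lambda>j. xs (j + N)) j \<in> K"
    by simp
  then obtain l s where s: "strict_mono s" "((\<lambda>j. xs (j + N)) \<circ> s) \<longlonglongrightarrow> l"
    using seq_compactE[OF compact_imp_seq_compact[OF \<open>compact K\<close>]] by metis
  then have "strict_mono (\<lambda>j. s j + N)" "(xs \<circ> (\<lambda>j. s j + N)) \<longlonglongrightarrow> l"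
    by (auto simp: strict_mono_def o_def)
  then show ?thesis by blast
qed

text \<open>Sublevel sets at real levels above the infimum are compact, hence closed, and any
  finitely many of them meet \<open>S\<close> in a common point. By compactness all of them do, and
  a point common to all is a minimizer. Real levels also cover an infimum of
  \<open>-\<infinity>\<close>.\<close>

lemma coercive_attains_min:
  fixes f :: "'a::t2_space \<Rightarrow> ereal"
  assumes "coercive f" and "closed S" and "S \<noteq> {}"
  shows "\<exists>x. is_arg_min f (\<lambda>x. x \<in> S) x"
proof (cases "(INF x\<in>S. f x) = \<infinity>")
  case True
  then have "f x = \<infinity>" if "x \<in> S" for x
    using that INF_lower[of x S f] by simp
  then show ?thesis
    using assms(3) by (auto simp: is_arg_min_def)
next
  case False
  let ?m = "INF x\<in>S. f x"
  define C where "C = {c::real. ?m < ereal c}"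
  have cpt: "compact {x. f x \<le> ereal c}" for c
    using assms(1) by (simp add: coercive_def)
  obtain a where a: "a \<in> C"
    using False ereal_dense2[of ?m \<infinity>] by (auto simp: C_def less_top)
  have "compact (S \<inter> {x. f x \<le> ereal a})"
    using assms(2) cpt by (simp add: closed_Int_compact)
  then have "(S \<inter> {x. f x \<le> ereal a}) \<inter> (\<Inter>c\<in>C. {x. f x \<le> ereal c}) \<noteq> {}"
  proof (rule compact_imp_fip_image)
    show "closed {x. f x \<le> ereal c}" for c
      using cpt by (rule compact_imp_closed)
  next
    fix J assume J: "finite J" "J \<subseteq> C"
    \<comment> \<open>Including \<open>a\<close> keeps the minimum defined for empty
      \<open>J\<close> and puts the point found below into the compact set at level
      \<open>a\<close>.\<close>
    define b where "b = Min (insert a J)"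
    have "b \<in> insert a J"
      unfolding b_def using J(1) by (intro Min_in) auto
    then have "?m < ereal b"
      using J(2) a by (auto simp: C_def)
    then obtain x where x: "x \<in> S" "f x < ereal b"
      by (auto simp: INF_less_iff)
    have "f x \<le> ereal c" if "c \<in> insert a J" for c
    proof -
      have "b \<le> c"
        unfolding b_def using J(1) that by (intro Min_le) auto
      then show ?thesis
        using x(2) by (meson ereal_less_eq(3) less_imp_le order.trans)
    qed
    then show "(S \<inter> {x. f x \<le> ereal a}) \<inter> (\<Inter>c\<in>J. {x. f x \<le> ereal c}) \<noteq> {}"
      using x(1) by auto
  qed
  then obtain x where x: "x \<in> S" "\<And>c. c \<in> C \<Longrightarrow> f x \<le> ereal c"
    by auto
  have "f x \<le> ?m"
  proof (rule ccontr)
    assume "\<not> f x \<le> ?m"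
    then obtain c where "?m < ereal c" "ereal c < f x"
      by (meson ereal_dense2 not_le)
    then show False
      using x(2)[of c] by (auto simp: C_def)
  qed
  then have "f x \<le> f y" if "y \<in> S" for y
    using INF_lower[OF that] by (rule order.trans)
  then show ?thesis
    using x(1) by (auto simp: is_arg_min_def not_less)
qed

section \<open>Infima over the fibres of \<open>\<theta>\<close>\<close>

lemma fibre_inf_eq_arg_min:
  assumes "is_arg_min f (\<lambda>x. \<theta> x = y) x"
  shows "fibre_inf \<theta> f y = f x"
  unfolding fibre_inf_def using assms
  by (intro antisym INF_lower INF_greatest) (auto simp: is_arg_min_def not_less)

lemma INF_fibre_inf: "(INF y\<in>V. fibre_inf \<theta> f y) = (INF x\<in>\<theta> -` V. f x)"
  unfolding fibre_inf_def
  by (intro antisym INF_greatest) (auto intro!: INF_lower2 INF_lower)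

lemma gamma_converges_fibre_inf:
  fixes \<theta> :: "'a::metric_space \<Rightarrow> 'b::metric_space"
  assumes gam: "gamma_converges f g" and cont: "continuous_on UNIV \<theta>" and equi: "equi_coercive f"
  shows "gamma_converges (\<lambda>k. fibre_inf \<theta> (f k)) (fibre_inf \<theta> g)"
proof (rule gamma_convergesI)
  fix y :: 'b and V assume V: "y \<in> interior V"
  have "limsup (\<lambda>k. INF x\<in>\<theta> -` V. f k x) \<le> g x" if "\<theta> x = y" for x
  proof -
    have "open (\<theta> -` interior V)"
      using cont by (simp add: open_vimage)
    then have "x \<in> interior (\<theta> -` V)"
      using that V interior_subset[of V] by (intro interiorI[of "\<theta> -` interior V"]) auto
    then show ?thesis
      unfolding gamma_convergesD(2)[OF gam, symmetric] by (intro SUP_upper) auto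
  qed
  then show "limsup (\<lambda>k. INF y\<in>V. fibre_inf \<theta> (f k) y) \<le> fibre_inf \<theta> g y"
    unfolding INF_fibre_inf by (auto simp: fibre_inf_def intro: INF_greatest)
next
  fix y :: 'b
  let ?L = "SUP V\<in>{V. y \<in> interior V}. liminf (\<lambda>k. INF y\<in>V. fibre_inf \<theta> (f k) y)"
  show "fibre_inf \<theta> g y \<le> ?L"
  proof (rule ccontr)
    assume "\<not> fibre_inf \<theta> g y \<le> ?L"
    then obtain a where a: "?L < ereal a" "ereal a < fibre_inf \<theta> g y"
      by (meson ereal_dense2 not_le)
    define P where "P n k \<longleftrightarrow> (\<exists>x. dist (\<theta> x) y < inverse (Suc n) \<and> f k x < ereal a)" for n k
    \<comment> \<open>If \<open>P n k\<close> failed for all \<open>k > m\<close>, the infima over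
      this ball would eventually be at least \<open>a\<close>, forcing \<open>?L\<close> up to
      \<open>a\<close>.\<close>
    have freq: "\<exists>k>m. P n k" for m n
    proof (rule ccontr)
      let ?V = "ball y (inverse (real (Suc n)))"
      assume "\<not> (\<exists>k>m. P n k)"
      then have "ereal a \<le> (INF x\<in>\<theta> -` ?V. f k x)" if "k > m" for k
        using that by (intro INF_greatest) (force simp: P_def dist_commute not_less)
      then have "\<forall>\<^sub>F k in sequentially. ereal a \<le> (INF x\<in>\<theta> -` ?V. f k x)"
        by (auto simp: eventually_at_top_dense)
      then have "ereal a \<le> liminf (\<lambda>k. INF y\<in>?V. fibre_inf \<theta> (f k) y)"
        unfolding INF_fibre_inf by (rule Liminf_bounded)
      also have "\<dots> \<le> ?L"
        by (intro SUP_upper) (auto simp: interior_open)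
      finally show False
        using a(1) by simp
    qed
    \<comment> \<open>The radius shrinks along with the increasing choice of indices, so the images
      of the chosen points converge to \<open>y\<close>.\<close>
    have "\<exists>r. \<forall>n. P n (r n) \<and> r n < r (Suc n)"
      using freq by (intro dependent_nat_choice) blast+
    then obtain r where r: "\<And>n. P n (r n)" "strict_mono r"
      by (auto simp: strict_mono_Suc_iff)
    then obtain xs where xs: "\<And>n. dist (\<theta> (xs n)) y < inverse (Suc n)" "\<And>n. f (r n) (xs n) < ereal a"
      unfolding P_def by metis
    obtain x s where s: "strict_mono s" "(xs \<circ> s) \<longlonglongrightarrow> x"
      using equi_coercive_convergent_subseq[OF equi r(2), of xs a] xs(2) by (auto simp: less_imp_le)
    have "(\<lambda>n. dist (\<theta> (xs n)) y) \<longlonglongrightarrow> 0"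
      by (rule tendsto_sandwich[OF _ _ tendsto_const LIMSEQ_inverse_real_of_nat])
        (use xs(1) in \<open>auto simp: less_imp_le\<close>)
    then have "(\<lambda>n. \<theta> (xs n)) \<longlonglongrightarrow> y"
      by (rule tendsto_dist_iff[THEN iffD2])
    then have "(\<lambda>j. \<theta> ((xs \<circ> s) j)) \<longlonglongrightarrow> y"
      using LIMSEQ_subseq_LIMSEQ[OF _ s(1)] by (fastforce simp: o_def)
    moreover have "(\<lambda>j. \<theta> ((xs \<circ> s) j)) \<longlonglongrightarrow> \<theta> x"
      using continuous_on_tendsto_compose[OF cont s(2)] by simp
    ultimately have "\<theta> x = y"
      using LIMSEQ_unique by blast
    then have "fibre_inf \<theta> g y \<le> g x"
      by (auto simp: fibre_inf_def intro: INF_lower)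
    also have "g x \<le> liminf (\<lambda>j. f ((r \<circ> s) j) ((xs \<circ> s) j))"
      using gamma_converges_liminf_le[OF gam strict_mono_o[OF r(2) s(1)] s(2)] .
    also have "\<dots> \<le> liminf (\<lambda>j. ereal a)"
      using xs(2) by (intro Liminf_mono) (auto simp: less_imp_le)
    also have "\<dots> = ereal a"
      by (simp add: Liminf_const)
    finally show False
      using a(2) by simp
  qed
qed

text \<open>Continuity places \<open>x\<close> in the fibre over \<open>y\<close>. The minimal
  values converge to the fibre infimum of \<open>g\<close>, so the liminf inequality bounds
  \<open>g x\<close> by that infimum.\<close>

lemma limit_point_of_fibre_minimizers:
  fixes \<theta> :: "'a::metric_space \<Rightarrow> 'b::metric_space"
  assumes "gamma_converges f g" and "continuous_on UNIV \<theta>" and "ys \<longlonglongrightarrow> y"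
    and "(\<lambda>k. fibre_inf \<theta> (f k) (ys k)) \<longlonglongrightarrow> fibre_inf \<theta> g y"
    and min: "\<And>k. k \<ge> 1 \<Longrightarrow> is_arg_min (f k) (\<lambda>x. \<theta> x = ys k) (xs k)"
    and "seq_limit_point xs x"
  shows "is_arg_min g (\<lambda>x. \<theta> x = y) x" and "fibre_inf \<theta> g y = g x"
proof -
  obtain r where r: "strict_mono r" "(xs \<circ> r) \<longlonglongrightarrow> x"
    using assms(6) by (auto simp: seq_limit_point_def)
  have ge1: "\<forall>\<^sub>F j in sequentially. r j \<ge> 1"
    using filterlim_subseq[OF r(1)] by (simp add: filterlim_at_top)
  have "(\<lambda>j. \<theta> ((xs \<circ> r) j)) \<longlonglongrightarrow> \<theta> x"
    using continuous_on_tendsto_compose[OF assms(2) r(2)] by simp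
  moreover have "\<forall>\<^sub>F j in sequentially. \<theta> ((xs \<circ> r) j) = (ys \<circ> r) j"
    using ge1 by eventually_elim (use min in \<open>auto simp: is_arg_min_def\<close>)
  ultimately have "(ys \<circ> r) \<longlonglongrightarrow> \<theta> x"
    by (rule Lim_transform_eventually)
  then have fib: "\<theta> x = y"
    using LIMSEQ_subseq_LIMSEQ[OF assms(3) r(1)] LIMSEQ_unique by blast
  have "\<forall>\<^sub>F j in sequentially. ((\<lambda>k. fibre_inf \<theta> (f k) (ys k)) \<circ> r) j = f (r j) ((xs \<circ> r) j)"
    using ge1 by eventually_elim (use fibre_inf_eq_arg_min[OF min] in simp)
  then have "(\<lambda>j. f (r j) ((xs \<circ> r) j)) \<longlonglongrightarrow> fibre_inf \<theta> g y"
    by (rule Lim_transform_eventually[OF LIMSEQ_subseq_LIMSEQ[OF assms(4) r(1)]])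
  then have le: "g x \<le> fibre_inf \<theta> g y"
    using gamma_converges_liminf_le[OF assms(1) r] by (simp add: lim_imp_Liminf)
  have lower: "fibre_inf \<theta> g y \<le> g z" if "\<theta> z = y" for z
    using that by (auto simp: fibre_inf_def intro: INF_lower)
  show "is_arg_min g (\<lambda>x. \<theta> x = y) x"
    using fib order.trans[OF le lower] by (auto simp: is_arg_min_def not_less)
  show "fibre_inf \<theta> g y = g x"
    using le lower[OF fib] by (rule order.antisym[rotated])
qed

theorem theorem7p1:
  fixes f :: "nat \<Rightarrow> 'a::metric_space \<Rightarrow> ereal"
    and g :: "'a \<Rightarrow> ereal"
    and \<theta> :: "'a \<Rightarrow> 'b::metric_space"
  assumes "\<And>k x. k \<ge> 1 \<Longrightarrow> f k x \<noteq> -\<infinity>"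
    and "\<And>x. g x \<noteq> -\<infinity>"
    and "gamma_converges f g"
    and "continuous_on UNIV \<theta>"
    and "\<And>k. k \<ge> 1 \<Longrightarrow> coercive (f k)"
    and "equi_coercive f"
  shows "gamma_converges (\<lambda>k. fibre_inf \<theta> (f k)) (fibre_inf \<theta> g) \<and>
    (\<forall>y. \<exists>ys::nat \<Rightarrow> 'b.
      ys \<longlonglongrightarrow> y \<and>
      (\<lambda>k. fibre_inf \<theta> (f k) (ys k)) \<longlonglongrightarrow> fibre_inf \<theta> g y \<and>
      fibre_inf \<theta> g y \<noteq> -\<infinity> \<and>
      (fibre_inf \<theta> g y < \<infinity> \<longrightarrow>
        (\<forall>k\<ge>1. \<exists>x. is_arg_min (f k) (\<lambda>x. \<theta> x = ys k) x) \<and>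
        (\<forall>xs::nat \<Rightarrow> 'a. (\<forall>k\<ge>1. is_arg_min (f k) (\<lambda>x. \<theta> x = ys k) (xs k)) \<longrightarrow>
          (\<exists>x. seq_limit_point xs x) \<and>
          (\<forall>x. seq_limit_point xs x \<longrightarrow> is_arg_min g (\<lambda>x. \<theta> x = y) x))))"
proof (intro conjI allI)
  show gamma: "gamma_converges (\<lambda>k. fibre_inf \<theta> (f k)) (fibre_inf \<theta> g)"
    using assms(3,4,6) by (rule gamma_converges_fibre_inf)
  fix y
  obtain zs where zs: "zs \<longlonglongrightarrow> y" "(\<lambda>k. fibre_inf \<theta> (f k) (zs k)) \<longlonglongrightarrow> fibre_inf \<theta> g y"
    using gamma_converges_recovery_sequence[OF gamma] by blast
  show "\<exists>ys. ys \<longlonglongrightarrow> y \<and> (\<lambda>k. fibre_inf \<theta> (f k) (ys k)) \<longlonglongrightarrow> fibre_inf \<theta> g y \<and>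
      fibre_inf \<theta> g y \<noteq> -\<infinity> \<and>
      (fibre_inf \<theta> g y < \<infinity> \<longrightarrow>
        (\<forall>k\<ge>1. \<exists>x. is_arg_min (f k) (\<lambda>x. \<theta> x = ys k) x) \<and>
        (\<forall>xs. (\<forall>k\<ge>1. is_arg_min (f k) (\<lambda>x. \<theta> x = ys k) (xs k)) \<longrightarrow>
          (\<exists>x. seq_limit_point xs x) \<and>
          (\<forall>x. seq_limit_point xs x \<longrightarrow> is_arg_min g (\<lambda>x. \<theta> x = y) x)))"
  proof (cases "fibre_inf \<theta> g y < \<infinity>")
    \<comment> \<open>With an infinite infimum the claims on minimizers are vacuous, and the
      recovery sequence serves unchanged.\<close>
    case False
    with zs show ?thesis by auto
  next
    case True
    then obtain x0 where x0: "\<theta> x0 = y"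
      unfolding fibre_inf_def INF_less_iff by blast
    \<comment> \<open>The recovery sequence may leave the range of \<open>\<theta>\<close> for finitely many indices; there it is
      replaced by \<open>y\<close>, so that minimizers exist for every \<open>k \<ge> 1\<close>.\<close>
    define ys where "ys k = (if zs k \<in> range \<theta> then zs k else y)" for k
    obtain a where a: "fibre_inf \<theta> g y < ereal a"
      using True ereal_dense2 by blast
    have "\<forall>\<^sub>F k in sequentially. fibre_inf \<theta> (f k) (zs k) < ereal a"
      using zs(2) a by (rule order_tendstoD(2))
    \<comment> \<open>An infimum below \<open>a\<close> excludes an empty fibre, so
      \<open>zs k\<close> eventually lies in the range of \<open>\<theta>\<close>.\<close>
    then have eq: "\<forall>\<^sub>F k in sequentially. zs k = ys k"
      by eventually_elim (simp add: ys_def fibre_inf_def INF_less_iff, metis rangeI)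
    have ys: "ys \<longlonglongrightarrow> y"
      using zs(1) eq by (rule Lim_transform_eventually)
    have inf: "(\<lambda>k. fibre_inf \<theta> (f k) (ys k)) \<longlonglongrightarrow> fibre_inf \<theta> g y"
      using zs(2) by (rule Lim_transform_eventually) (use eq in eventually_elim, simp)
    have min: "\<exists>x. is_arg_min (f k) (\<lambda>x. \<theta> x = ys k) x" if "k \<ge> 1" for k
    proof -
      have "closed (\<theta> -` {ys k})"
        using assms(4) by (simp add: closed_vimage)
      moreover have "\<theta> -` {ys k} \<noteq> {}"
        using x0 by (auto simp: ys_def)
      ultimately show ?thesis
        using coercive_attains_min[OF assms(5)[OF that], of "\<theta> -` {ys k}"] by simp
    qed
    have limit: "\<exists>x. seq_limit_point xs x"
      if xs: "\<And>k. k \<ge> 1 \<Longrightarrow> is_arg_min (f k) (\<lambda>x. \<theta> x = ys k) (xs k)" for xs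
    proof -
      have "\<forall>\<^sub>F k in sequentially. f (id k) (xs k) \<le> ereal a"
        using order_tendstoD(2)[OF inf a] eventually_ge_at_top[of 1]
        by eventually_elim (use fibre_inf_eq_arg_min[OF xs] in auto)
      then show ?thesis
        using equi_coercive_convergent_subseq[OF assms(6) strict_mono_id]
        unfolding seq_limit_point_def by blast
    qed
    note limit_min = limit_point_of_fibre_minimizers[OF assms(3,4) ys inf]
    \<comment> \<open>A limit point of minimizers attains the fibre infimum of \<open>g\<close>,
      which therefore inherits from \<open>g\<close> that it is not
      \<open>-\<infinity>\<close>.\<close>
    obtain xs where xs: "\<And>k. k \<ge> 1 \<Longrightarrow> is_arg_min (f k) (\<lambda>x. \<theta> x = ys k) (xs k)"
      using min by metis
    then obtain x where "seq_limit_point xs x"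
      using limit by blast
    then have "fibre_inf \<theta> g y \<noteq> -\<infinity>"
      using limit_min(2)[OF xs] assms(2) by simp
    then show ?thesis
      using ys inf min limit limit_min(1) by (intro exI[of _ ys]) blast
  qed
qed

end
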